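(* Every triangle-free Toeplitz-row graph is a disjoint union of cycles and paths.
   Context: Write $[m]=\{1,\dots,m\}$. For disjoint subsets $\alpha,\beta\subseteq[n-1]$, not both empty, $T_n\langle\alpha;\beta\rangle$ denotes the $n\times n$ $(0,1)$-matrix $(t_{u,v})$ with $t_{u,v}=1$ if and only if $u-v\in\alpha$ or $v-u\in\beta$. The row graph $\mathrm{RG}(T)$ of an $n\times n$ $(0,1)$-matrix $T=(t_{u,v})$ is the simple graph with vertex set $[n]$ in which two distinct vertices $u,v$ are adjacent if and only if $t_{u,k}=t_{v,k}=1$ for some $k\in[n]$. A Toeplitz-row graph is a graph (isomorphic to one) of the form $\mathrm{RG}(T)$ for some $T=T_n\langle\alpha;\beta\rangle$. An isolated vertex counts as a path (of length $0$). *)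

theory Defs
  imports Main "HOL-Library.Disjoint_Sets"
begin

record 'a sgraph =
  verts :: "'a set"
  edges :: "'a set set"

(* The image condition transports every edge of G to an edge of H and conversely, so a graph
   isomorphic to a simple graph is itself simple: its edges are 2-element sets of vertices. *)
definition graph_iso :: "'a sgraph \<Rightarrow> 'b sgraph \<Rightarrow> bool" where
  "graph_iso G H \<longleftrightarrow>
     (\<exists>f. bij_betw f (verts G) (verts H) \<and> edges G \<subseteq> Pow (verts G) \<and>
          edges H = (\<lambda>e. f ` e) ` edges G)"

definition triangle_free :: "'a sgraph \<Rightarrow> bool" where
  "triangle_free G \<longleftrightarrow>
     \<not> (\<exists>u v w. distinct [u, v, w] \<and> {u, v} \<in> edges G \<and> {v, w} \<in> edges G \<and> {u, w} \<in> edges G)"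

(* An n x n matrix is a function of which only the values at (u, v) with u, v in {1..n} matter;
   the size n is supplied to row_graph. Differences are taken in the integers. *)
definition toeplitz_matrix :: "nat set \<Rightarrow> nat set \<Rightarrow> nat \<Rightarrow> nat \<Rightarrow> nat" where
  "toeplitz_matrix \<alpha> \<beta> u v =
     (if int u - int v \<in> int ` \<alpha> \<or> int v - int u \<in> int ` \<beta> then 1 else 0)"

definition row_graph :: "nat \<Rightarrow> (nat \<Rightarrow> nat \<Rightarrow> nat) \<Rightarrow> nat sgraph" where
  "row_graph n T =
     \<lparr> verts = {1..n},
       edges = {{u, v} | u v. u \<in> {1..n} \<and> v \<in> {1..n} \<and> u \<noteq> v \<and>
                              (\<exists>k\<in>{1..n}. T u k = 1 \<and> T v k = 1)} \<rparr>"

definition toeplitz_row_graph :: "'a sgraph \<Rightarrow> bool" where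
  "toeplitz_row_graph G \<longleftrightarrow>
     (\<exists>n \<alpha> \<beta>. \<alpha> \<subseteq> {1..n - 1} \<and> \<beta> \<subseteq> {1..n - 1} \<and> \<alpha> \<inter> \<beta> = {} \<and> \<alpha> \<union> \<beta> \<noteq> {} \<and>
              graph_iso G (row_graph n (toeplitz_matrix \<alpha> \<beta>)))"

(* The path on m vertices, of length m - 1. *)
definition path_graph :: "nat \<Rightarrow> nat sgraph" where
  "path_graph m = \<lparr> verts = {1..m}, edges = {{i, i + 1} | i. 1 \<le> i \<and> i < m} \<rparr>"

definition cycle_graph :: "nat \<Rightarrow> nat sgraph" where
  "cycle_graph m = \<lparr> verts = {1..m}, edges = insert {m, 1} {{i, i + 1} | i. 1 \<le> i \<and> i < m} \<rparr>"

(* A single vertex (m = 1) is a path of length 0. *)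
definition is_path :: "'a sgraph \<Rightarrow> bool" where
  "is_path G \<longleftrightarrow> (\<exists>m\<ge>1. graph_iso G (path_graph m))"

definition is_cycle :: "'a sgraph \<Rightarrow> bool" where
  "is_cycle G \<longleftrightarrow> (\<exists>m\<ge>3. graph_iso G (cycle_graph m))"

definition is_disjoint_union :: "'a sgraph \<Rightarrow> 'a sgraph set \<Rightarrow> bool" where
  "is_disjoint_union G \<H> \<longleftrightarrow>
     disjoint_family_on verts \<H> \<and>
     verts G = (\<Union>H\<in>\<H>. verts H) \<and> edges G = (\<Union>H\<in>\<H>. edges H)"

end

theory Submission
  imports Defs
begin

text \<open>A triangle-free row graph comes from a matrix without three ones in a column, because the
  rows of any three such ones are pairwise adjacent. A Toeplitz matrix is symmetric about its
  antidiagonal, and the reflection exchanges rows and columns, so there are no three ones in a row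
  either. Every neighbour of \<open>u\<close> shares with \<open>u\<close> one of the at most two columns where
  row \<open>u\<close> has a one, and each of these columns accounts for at most one neighbour; hence all degrees
  are at most two (\<open>toeplitz_row_graph_degree\<close>).

  The rest is the classification of finite simple graphs of maximum degree two
  (\<open>paths_and_cycles_if_max_degree_two\<close>). A path of maximum length spans a whole component:
  its interior vertices already have two neighbours on the path, and its ends have no neighbour
  outside. The only possible further edge joins the two ends and closes the path to a cycle.
  Splitting this component off reduces the number of vertices.\<close>

section \<open>Simple graphs and isomorphisms\<close>

definition simple_graph :: "'a sgraph \<Rightarrow> bool" where
  "simple_graph G \<longleftrightarrow> finite (verts G) \<and>
     (\<forall>e\<in>edges G. \<exists>u v. e = {u, v} \<and> u \<noteq> v \<and> u \<in> verts G \<and> v \<in> verts G)"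

definition max_degree_two :: "'a sgraph \<Rightarrow> bool" where
  "max_degree_two G \<longleftrightarrow>
     (\<forall>u a b c. {u, a} \<in> edges G \<longrightarrow> {u, b} \<in> edges G \<longrightarrow> {u, c} \<in> edges G \<longrightarrow> \<not> distinct [a, b, c])"

lemma simple_graph_edgeD:
  assumes "simple_graph G" "{u, v} \<in> edges G"
  shows "u \<noteq> v" "u \<in> verts G" "v \<in> verts G"
  using assms unfolding simple_graph_def by (metis doubleton_eq_iff)+

lemma graph_isoE:
  assumes "graph_iso G H"
  obtains f where "bij_betw f (verts G) (verts H)" "edges G \<subseteq> Pow (verts G)"
    "edges H = (\<lambda>e. f ` e) ` edges G"
  using assms that unfolding graph_iso_def by (elim exE conjE)

lemma graph_isoI:
  assumes "bij_betw f (verts G) (verts H)" "edges G \<subseteq> Pow (verts G)"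
    "edges H = (\<lambda>e. f ` e) ` edges G"
  shows "graph_iso G H"
  using assms unfolding graph_iso_def by (intro exI[of _ f] conjI)

lemma graph_iso_sym:
  assumes "graph_iso G H"
  shows "graph_iso H G"
proof -
  obtain f where f: "bij_betw f (verts G) (verts H)" "edges G \<subseteq> Pow (verts G)"
    "edges H = (\<lambda>e. f ` e) ` edges G"
    using graph_isoE[OF assms] .
  let ?g = "the_inv_into (verts G) f"
  have inj: "inj_on f (verts G)" using f(1) by (simp add: bij_betw_def)
  have inverse: "?g ` f ` e = e" if "e \<in> edges G" for e
  proof -
    have "e \<subseteq> verts G" using f(2) that by blast
    hence "\<And>x. x \<in> e \<Longrightarrow> ?g (f x) = x" using the_inv_into_f_f[OF inj] by blast
    thus ?thesis by (force simp: image_image)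
  qed
  have "edges H \<subseteq> Pow (verts H)"
    unfolding f(3) bij_betw_imp_surj_on[OF f(1), symmetric] using f(2) by (auto intro!: imageI)
  moreover have "edges G = (\<lambda>e. ?g ` e) ` edges H"
    unfolding f(3) image_comp using inverse by simp
  ultimately show ?thesis
    using graph_isoI[OF bij_betw_the_inv_into[OF f(1)]] by blast
qed

lemma triangle_free_iso:
  assumes "graph_iso G H" "triangle_free G"
  shows "triangle_free H"
proof -
  obtain f where f: "bij_betw f (verts H) (verts G)" "edges H \<subseteq> Pow (verts H)"
    "edges G = (\<lambda>e. f ` e) ` edges H"
    using graph_isoE[OF graph_iso_sym[OF assms(1)]] .
  have image_edge: "{f x, f y} \<in> edges G" if "{x, y} \<in> edges H" for x y
    using imageI[OF that, of "\<lambda>e. f ` e"] f(3) by simp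
  have inj: "inj_on f (verts H)" using f(1) by (simp add: bij_betw_def)
  show ?thesis unfolding triangle_free_def
  proof clarify
    fix u v w
    assume d: "distinct [u, v, w]"
      and e: "{u, v} \<in> edges H" "{v, w} \<in> edges H" "{u, w} \<in> edges H"
    have "u \<in> verts H" "v \<in> verts H" "w \<in> verts H" using e f(2) by auto
    hence "distinct [f u, f v, f w]" using d inj_onD[OF inj] by auto
    moreover have "{f u, f v} \<in> edges G" "{f v, f w} \<in> edges G" "{f u, f w} \<in> edges G"
      using e image_edge by blast+
    ultimately show False using assms(2) unfolding triangle_free_def by blast
  qed
qed

lemma max_degree_two_iso:
  assumes "graph_iso G H" "max_degree_two H"
  shows "max_degree_two G"
proof -
  obtain f where f: "bij_betw f (verts G) (verts H)" "edges G \<subseteq> Pow (verts G)"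
    "edges H = (\<lambda>e. f ` e) ` edges G"
    using graph_isoE[OF assms(1)] .
  have image_edge: "{f x, f y} \<in> edges H" if "{x, y} \<in> edges G" for x y
    using imageI[OF that, of "\<lambda>e. f ` e"] f(3) by simp
  have inj: "inj_on f (verts G)" using f(1) by (simp add: bij_betw_def)
  show ?thesis unfolding max_degree_two_def
  proof (intro allI impI notI)
    fix u a b c
    assume e: "{u, a} \<in> edges G" "{u, b} \<in> edges G" "{u, c} \<in> edges G"
      and d: "distinct [a, b, c]"
    have "a \<in> verts G" "b \<in> verts G" "c \<in> verts G" using e f(2) by auto
    hence "distinct [f a, f b, f c]" using d inj_onD[OF inj] by auto
    moreover have "{f u, f a} \<in> edges H" "{f u, f b} \<in> edges H" "{f u, f c} \<in> edges H"
      using e image_edge by blast+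
    ultimately show False using assms(2) unfolding max_degree_two_def by blast
  qed
qed

lemma simple_graph_iso:
  assumes "graph_iso G H" "simple_graph H"
  shows "simple_graph G"
proof -
  obtain f where f: "bij_betw f (verts H) (verts G)" "edges H \<subseteq> Pow (verts H)"
    "edges G = (\<lambda>e. f ` e) ` edges H"
    using graph_isoE[OF graph_iso_sym[OF assms(1)]] .
  have inj: "inj_on f (verts H)" and im: "f ` verts H = verts G"
    using f(1) by (simp_all add: bij_betw_def)
  have "\<exists>u v. e = {u, v} \<and> u \<noteq> v \<and> u \<in> verts G \<and> v \<in> verts G" if e: "e \<in> edges G" for e
  proof -
    obtain e' where e': "e' \<in> edges H" "e = f ` e'" using e unfolding f(3) by (elim imageE)
    obtain u v where uv: "e = f ` {u, v}" "u \<noteq> v" "u \<in> verts H" "v \<in> verts H"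
      using assms(2) e' unfolding simple_graph_def by metis
    have "f u \<in> verts G" "f v \<in> verts G" using uv(3,4) im by blast+
    moreover have "f u \<noteq> f v" using uv(2-4) inj_on_eq_iff[OF inj] by blast
    ultimately show ?thesis using uv(1) by (intro exI[of _ "f u"] exI[of _ "f v"]) simp
  qed
  moreover have "finite (verts G)"
    using assms(2) unfolding simple_graph_def im[symmetric] by simp
  ultimately show ?thesis unfolding simple_graph_def by (intro conjI ballI)
qed

section \<open>Row graphs of Toeplitz matrices\<close>

lemma row_graph_edge_iff:
  "{u, v} \<in> edges (row_graph n T) \<longleftrightarrow>
     u \<in> {1..n} \<and> v \<in> {1..n} \<and> u \<noteq> v \<and> (\<exists>k\<in>{1..n}. T u k = 1 \<and> T v k = 1)"
  unfolding row_graph_def by (auto simp: doubleton_eq_iff)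

lemma simple_row_graph: "simple_graph (row_graph n T)"
  unfolding simple_graph_def row_graph_def by auto

lemma triangle_free_column:
  assumes "triangle_free (row_graph n T)" "k \<in> {1..n}"
    and "u \<in> {1..n}" "v \<in> {1..n}" "w \<in> {1..n}"
    and "T u k = 1" "T v k = 1" "T w k = 1"
  shows "\<not> distinct [u, v, w]"
proof
  assume d: "distinct [u, v, w]"
  have "{u, v} \<in> edges (row_graph n T)" "{v, w} \<in> edges (row_graph n T)"
    "{u, w} \<in> edges (row_graph n T)"
    unfolding row_graph_edge_iff using assms(2-) d by auto
  thus False using d assms(1) unfolding triangle_free_def by blast
qed

text \<open>Reflection in the antidiagonal preserves the difference of row and column index, on which alone
  the entries of a Toeplitz matrix depend.\<close>

lemma toeplitz_matrix_antidiagonal: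
  assumes "u \<in> {1..n}" "k \<in> {1..n}"
  shows "toeplitz_matrix \<alpha> \<beta> (n + 1 - k) (n + 1 - u) = toeplitz_matrix \<alpha> \<beta> u k"
proof -
  have "int (n + 1 - k) - int (n + 1 - u) = int u - int k"
    "int (n + 1 - u) - int (n + 1 - k) = int k - int u"
    using assms by auto
  thus ?thesis unfolding toeplitz_matrix_def by (simp only:)
qed

text \<open>Three ones in row \<open>u\<close> would reflect to three ones in column \<open>n + 1 - u\<close>.\<close>

lemma triangle_free_toeplitz_row:
  assumes tf: "triangle_free (row_graph n (toeplitz_matrix \<alpha> \<beta>))" and u: "u \<in> {1..n}"
    and k: "k \<in> {1..n}" "l \<in> {1..n}" "m \<in> {1..n}"
    and ones: "toeplitz_matrix \<alpha> \<beta> u k = 1" "toeplitz_matrix \<alpha> \<beta> u l = 1"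
      "toeplitz_matrix \<alpha> \<beta> u m = 1"
  shows "\<not> distinct [k, l, m]"
proof
  assume d: "distinct [k, l, m]"
  have "n + 1 - u \<in> {1..n}" "n + 1 - k \<in> {1..n}" "n + 1 - l \<in> {1..n}" "n + 1 - m \<in> {1..n}"
    using u k by auto
  moreover have "distinct [n + 1 - k, n + 1 - l, n + 1 - m]" using d k by auto
  ultimately show False
    using triangle_free_column[OF tf, of "n + 1 - u" "n + 1 - k" "n + 1 - l" "n + 1 - m"]
      toeplitz_matrix_antidiagonal u k ones by metis
qed

text \<open>Three neighbours of \<open>u\<close> meet row \<open>u\<close> in columns \<open>k\<close>, \<open>l\<close>, \<open>m\<close>. If two of these columns
  coincide, that column has three ones; otherwise row \<open>u\<close> has.\<close>

lemma toeplitz_row_graph_degree: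
  assumes tf: "triangle_free (row_graph n (toeplitz_matrix \<alpha> \<beta>))"
  shows "max_degree_two (row_graph n (toeplitz_matrix \<alpha> \<beta>))"
  unfolding max_degree_two_def
proof (intro allI impI notI)
  let ?T = "toeplitz_matrix \<alpha> \<beta>"
  fix u a b c
  assume e: "{u, a} \<in> edges (row_graph n ?T)" "{u, b} \<in> edges (row_graph n ?T)"
      "{u, c} \<in> edges (row_graph n ?T)"
    and d: "distinct [a, b, c]"
  obtain k l m where klm: "k \<in> {1..n}" "l \<in> {1..n}" "m \<in> {1..n}"
    and one: "?T u k = 1" "?T u l = 1" "?T u m = 1" "?T a k = 1" "?T b l = 1" "?T c m = 1"
    using e unfolding row_graph_edge_iff by blast
  have V: "u \<in> {1..n}" "a \<in> {1..n}" "b \<in> {1..n}" "c \<in> {1..n}"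
    and ne: "u \<noteq> a" "u \<noteq> b" "u \<noteq> c"
    using e unfolding row_graph_edge_iff by auto
  have "k \<noteq> l" using triangle_free_column[OF tf klm(1) V(1,2,3)] one d ne by auto
  moreover have "k \<noteq> m" using triangle_free_column[OF tf klm(1) V(1,2,4)] one d ne by auto
  moreover have "l \<noteq> m" using triangle_free_column[OF tf klm(2) V(1,3,4)] one d ne by auto
  ultimately show False
    using triangle_free_toeplitz_row[OF tf V(1) klm] one by auto
qed

section \<open>Longest paths in graphs of maximum degree two\<close>

text \<open>The vertices are numbered from 1, as in the standard path and cycle.\<close>

definition path_in :: "'a sgraph \<Rightarrow> nat \<Rightarrow> (nat \<Rightarrow> 'a) \<Rightarrow> bool" where
  "path_in G m p \<longleftrightarrow> inj_on p {1..m} \<and> p ` {1..m} \<subseteq> verts G \<and>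
     (\<forall>i. 1 \<le> i \<and> i < m \<longrightarrow> {p i, p (i + 1)} \<in> edges G)"

definition longest_path_in :: "'a sgraph \<Rightarrow> nat \<Rightarrow> (nat \<Rightarrow> 'a) \<Rightarrow> bool" where
  "longest_path_in G m p \<longleftrightarrow> path_in G m p \<and> (\<forall>m' p'. path_in G m' p' \<longrightarrow> m' \<le> m)"

lemma longest_path_exists:
  assumes fin: "finite (verts G)" and "verts G \<noteq> {}"
  obtains m p where "longest_path_in G m p" "1 \<le> m"
proof -
  obtain x where "x \<in> verts G" using assms(2) by blast
  hence one: "path_in G 1 (\<lambda>_. x)" unfolding path_in_def by auto
  have bound: "m \<le> card (verts G)" if "path_in G m p" for m p
  proof -
    have "card (p ` {1..m}) = m" using that unfolding path_in_def by (simp add: card_image)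
    thus ?thesis using that card_mono[OF fin] unfolding path_in_def by metis
  qed
  let ?P = "\<lambda>m. \<exists>p. path_in G m p"
  have P: "?P (GREATEST m. ?P m)"
    by (rule GreatestI_nat[of ?P 1 "card (verts G)"]) (use one bound in blast)+
  have G: "m \<le> (GREATEST m. ?P m)" if "?P m" for m
    by (rule Greatest_le_nat[of ?P m "card (verts G)"]) (use that bound in blast)+
  obtain p where "path_in G (GREATEST m. ?P m) p" using P by blast
  hence "longest_path_in G (GREATEST m. ?P m) p"
    unfolding longest_path_in_def using G by blast
  thus thesis using that G one by blast
qed

lemma path_in_edge: "path_in G m p \<Longrightarrow> 1 \<le> i \<Longrightarrow> i < m \<Longrightarrow> {p i, p (i + 1)} \<in> edges G"
  unfolding path_in_def by blast

lemma path_in_vertex: "path_in G m p \<Longrightarrow> i \<in> {1..m} \<Longrightarrow> p i \<in> verts G"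
  unfolding path_in_def by blast

lemma path_in_eq_iff: "path_in G m p \<Longrightarrow> i \<in> {1..m} \<Longrightarrow> j \<in> {1..m} \<Longrightarrow> p i = p j \<longleftrightarrow> i = j"
  unfolding path_in_def using inj_on_eq_iff by metis

lemma longest_path_in_rev:
  assumes "longest_path_in G m p"
  shows "longest_path_in G m (\<lambda>i. p (m + 1 - i))"
proof -
  have p: "path_in G m p" using assms unfolding longest_path_in_def by blast
  have flip: "m + 1 - i \<in> {1..m}" if "i \<in> {1..m}" for i using that by auto
  have "path_in G m (\<lambda>i. p (m + 1 - i))"
    unfolding path_in_def
  proof (intro conjI allI impI inj_onI image_subsetI)
    fix i j assume ij: "i \<in> {1..m}" "j \<in> {1..m}" "p (m + 1 - i) = p (m + 1 - j)"
    hence "m + 1 - i = m + 1 - j" using path_in_eq_iff[OF p flip flip] by blast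
    thus "i = j" using ij(1,2) by auto
  next
    fix i assume "i \<in> {1..m}"
    thus "p (m + 1 - i) \<in> verts G" using path_in_vertex[OF p flip] by blast
  next
    fix i assume i: "1 \<le> i \<and> i < m"
    hence "{p (m - i), p (m - i + 1)} \<in> edges G" by (intro path_in_edge[OF p]) auto
    moreover have "m - i + 1 = m + 1 - i" "m - i = m + 1 - (i + 1)" using i by auto
    ultimately show "{p (m + 1 - i), p (m + 1 - (i + 1))} \<in> edges G"
      by (simp only: insert_commute)
  qed
  thus ?thesis using assms unfolding longest_path_in_def by blast
qed

text \<open>A neighbour of the last vertex outside the path would extend it.\<close>

lemma longest_path_end_neighbour:
  assumes G: "simple_graph G" and longest: "longest_path_in G m p" and e: "{p m, x} \<in> edges G"
  shows "x \<in> p ` {1..m}"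
proof (rule ccontr)
  assume x: "x \<notin> p ` {1..m}"
  let ?q = "p(m + 1 := x)"
  have p: "path_in G m p" using longest unfolding longest_path_in_def by blast
  have same: "?q ` {1..m} = p ` {1..m}" by (intro image_cong) auto
  have split: "{1..m + 1} = insert (m + 1) {1..m}" by auto
  have "path_in G (m + 1) ?q"
    unfolding path_in_def
  proof (intro conjI allI impI)
    have "inj_on ?q {1..m}" using p x unfolding path_in_def by (intro inj_on_fun_updI) blast+
    moreover have "?q (m + 1) \<notin> ?q ` ({1..m} - {m + 1})" using x same by auto
    ultimately show "inj_on ?q {1..m + 1}" unfolding split inj_on_insert by blast
    show "?q ` {1..m + 1} \<subseteq> verts G"
      unfolding split image_insert same
      using p simple_graph_edgeD(3)[OF G e] unfolding path_in_def by simp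
    fix i assume i: "1 \<le> i \<and> i < m + 1"
    show "{?q i, ?q (i + 1)} \<in> edges G"
    proof (cases "i = m")
      case True
      thus ?thesis using e by simp
    next
      case False
      thus ?thesis using i path_in_edge[OF p, of i] by simp
    qed
  qed
  hence "m + 1 \<le> m" using longest unfolding longest_path_in_def by blast
  thus False by simp
qed

lemma path_interior_neighbour:
  assumes deg: "max_degree_two G" and p: "path_in G m p" and i: "1 < i" "i < m"
    and e: "{p i, x} \<in> edges G"
  shows "x = p (i - 1) \<or> x = p (i + 1)"
proof (rule ccontr)
  assume x: "\<not> (x = p (i - 1) \<or> x = p (i + 1))"
  have "{p i, p (i - 1)} \<in> edges G"
    using path_in_edge[OF p, of "i - 1"] i by (simp add: insert_commute)
  moreover have "{p i, p (i + 1)} \<in> edges G" using path_in_edge[OF p] i by simp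
  moreover have "i - 1 \<in> {1..m}" "i + 1 \<in> {1..m}" using i by auto
  hence "p (i - 1) \<noteq> p (i + 1)" using path_in_eq_iff[OF p, of "i - 1" "i + 1"] by simp
  hence "distinct [x, p (i - 1), p (i + 1)]" using x by simp
  ultimately show False using deg e unfolding max_degree_two_def by blast
qed

text \<open>By maximality a neighbour of the last vertex lies on the path, and it cannot be an interior
  vertex other than the last but one, since that vertex already has its two neighbours.\<close>

lemma longest_path_end_edge:
  assumes G: "simple_graph G" "max_degree_two G" and p: "longest_path_in G m p"
    and e: "{p m, x} \<in> edges G"
  shows "(1 < m \<and> x = p (m - 1)) \<or> (3 \<le> m \<and> x = p 1)"
proof -
  have pin: "path_in G m p" using p unfolding longest_path_in_def by blast
  obtain j where j: "j \<in> {1..m}" "x = p j"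
    using longest_path_end_neighbour[OF G(1) p e] by blast
  have "j \<noteq> m" using simple_graph_edgeD(1)[OF G(1) e] j by auto
  have "j = 1 \<or> j = m - 1"
  proof (rule ccontr)
    assume n: "\<not> (j = 1 \<or> j = m - 1)"
    have "p m = p (j - 1) \<or> p m = p (j + 1)"
      by (rule path_interior_neighbour[OF G(2) pin])
        (use n j e \<open>j \<noteq> m\<close> in \<open>auto simp: insert_commute\<close>)
    moreover have "m \<in> {1..m}" "j - 1 \<in> {1..m}" "j + 1 \<in> {1..m}"
      using n j(1) \<open>j \<noteq> m\<close> by auto
    ultimately have "m = j - 1 \<or> m = j + 1" using path_in_eq_iff[OF pin] by blast
    thus False using n j(1) by auto
  qed
  thus ?thesis using j \<open>j \<noteq> m\<close> by (cases "m = 2") auto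
qed

text \<open>An edge joining the two ends counts as additional only for \<open>3 \<le> m\<close>; for \<open>m = 2\<close> it is the
  edge of the path itself.\<close>

lemma longest_path_edge_cases:
  assumes G: "simple_graph G" "max_degree_two G" and p: "longest_path_in G m p"
    and i: "i \<in> {1..m}" and e: "{p i, x} \<in> edges G"
  shows "(\<exists>j. 1 \<le> j \<and> j < m \<and> {p i, x} = {p j, p (j + 1)}) \<or> (3 \<le> m \<and> {p i, x} = {p m, p 1})"
proof -
  have pin: "path_in G m p" using p unfolding longest_path_in_def by blast
  consider "1 < i" "i < m" | "i = m" | "i = 1" using i by fastforce
  thus ?thesis
  proof cases
    case 1
    hence "x = p (i - 1) \<or> x = p (i + 1)" using path_interior_neighbour[OF G(2) pin] e by blast
    thus ?thesis
    proof
      assume "x = p (i - 1)"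
      hence "1 \<le> i - 1 \<and> i - 1 < m \<and> {p i, x} = {p (i - 1), p (i - 1 + 1)}" using 1 by auto
      thus ?thesis by blast
    next
      assume "x = p (i + 1)"
      thus ?thesis using 1 by (intro disjI1 exI[of _ i]) auto
    qed
  next
    case 2
    hence "(1 < m \<and> x = p (m - 1)) \<or> (3 \<le> m \<and> x = p 1)"
      using longest_path_end_edge[OF G p] e by blast
    thus ?thesis
    proof
      assume x: "1 < m \<and> x = p (m - 1)"
      hence "1 \<le> m - 1 \<and> m - 1 < m \<and> {p i, x} = {p (m - 1), p (m - 1 + 1)}" using 2 by auto
      thus ?thesis by blast
    next
      assume "3 \<le> m \<and> x = p 1"
      thus ?thesis using 2 by blast
    qed
  next
    case 3
    \<comment> \<open>The first vertex is the last one of the reversed path.\<close>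
    have "(1 < m \<and> x = p (m + 1 - (m - 1))) \<or> (3 \<le> m \<and> x = p (m + 1 - 1))"
      using e 3 by (intro longest_path_end_edge[OF G longest_path_in_rev[OF p]]) simp
    thus ?thesis
    proof
      assume x: "1 < m \<and> x = p (m + 1 - (m - 1))"
      hence "m + 1 - (m - 1) = 1 + 1" by simp
      hence "1 \<le> (1 :: nat) \<and> 1 < m \<and> {p i, x} = {p 1, p (1 + 1)}" using x 3 by (simp only:) simp
      thus ?thesis by blast
    next
      assume "3 \<le> m \<and> x = p (m + 1 - 1)"
      hence "3 \<le> m \<and> {p i, x} = {p m, p 1}" using 3 by auto
      thus ?thesis by blast
    qed
  qed
qed

section \<open>Splitting off a component\<close>

definition spanned :: "'a sgraph \<Rightarrow> 'a set \<Rightarrow> 'a sgraph" where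
  "spanned G S = \<lparr> verts = S, edges = {e \<in> edges G. e \<subseteq> S} \<rparr>"

text \<open>The edges spanned by a longest path are those of the path and possibly the one that joins its
  ends, so its numbering is an isomorphism from a standard path or cycle.\<close>

lemma longest_path_spans_path_or_cycle:
  assumes G: "simple_graph G" "max_degree_two G" and p: "longest_path_in G m p" and m: "1 \<le> m"
  defines "C \<equiv> spanned G (p ` {1..m})"
  shows "is_cycle C \<or> is_path C"
proof -
  have pin: "path_in G m p" using p unfolding longest_path_in_def by blast
  have bij: "bij_betw p {1..m} (verts C)"
    using pin unfolding path_in_def bij_betw_def C_def spanned_def by auto
  let ?E = "{{p j, p (j + 1)} | j. 1 \<le> j \<and> j < m}"
  have path_edges: "?E \<subseteq> edges C"
    using pin unfolding path_in_def C_def spanned_def by auto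
  have all_edges: "e \<in> ?E \<or> 3 \<le> m \<and> e = {p m, p 1}" if e: "e \<in> edges C" for e
  proof -
    obtain i x where "e = {p i, x}" "i \<in> {1..m}" "{p i, x} \<in> edges G"
      using e G(1) unfolding C_def spanned_def simple_graph_def by fastforce
    thus ?thesis using longest_path_edge_cases[OF G p] by blast
  qed
  have image: "(\<lambda>e. p ` e) ` {{i, i + 1} | i. 1 \<le> i \<and> i < m} = ?E"
    unfolding setcompr_eq_image image_image by simp
  show ?thesis
  proof (cases "3 \<le> m \<and> {p m, p 1} \<in> edges C")
    case True
    have "edges C = insert {p m, p 1} ?E" using True path_edges all_edges by blast
    also have "\<dots> = (\<lambda>e. p ` e) ` edges (cycle_graph m)"
      unfolding cycle_graph_def using image by simp
    finally have "graph_iso (cycle_graph m) C"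
      using bij m by (intro graph_isoI[of p]) (auto simp: cycle_graph_def)
    thus ?thesis using True graph_iso_sym unfolding is_cycle_def by blast
  next
    case False
    have "edges C = ?E" using False path_edges all_edges by blast
    also have "\<dots> = (\<lambda>e. p ` e) ` edges (path_graph m)"
      unfolding path_graph_def using image by simp
    finally have "graph_iso (path_graph m) C"
      using bij by (intro graph_isoI[of p]) (auto simp: path_graph_def)
    thus ?thesis using m graph_iso_sym unfolding is_path_def by blast
  qed
qed

lemma longest_path_closed:
  assumes G: "simple_graph G" "max_degree_two G" and p: "longest_path_in G m p"
    and e: "e \<in> edges G" "e \<inter> p ` {1..m} \<noteq> {}"
  shows "e \<subseteq> p ` {1..m}"
proof -
  obtain i x where ix: "e = {p i, x}" "i \<in> {1..m}"
    using e G(1) unfolding simple_graph_def by fastforce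
  from longest_path_edge_cases[OF G p ix(2)] e(1) ix(1)
  consider j where "1 \<le> j" "j < m" "e = {p j, p (j + 1)}" | "3 \<le> m" "e = {p m, p 1}"
    by blast
  thus ?thesis by cases simp_all
qed

text \<open>The vertices off a longest path span a smaller graph to which induction applies, and no edge
  joins them to the path.\<close>

theorem paths_and_cycles_if_max_degree_two:
  assumes "simple_graph G" "max_degree_two G"
  shows "\<exists>\<H>. is_disjoint_union G \<H> \<and> (\<forall>H\<in>\<H>. is_cycle H \<or> is_path H)"
  using assms
proof (induction "card (verts G)" arbitrary: G rule: less_induct)
  case less
  note G = less.prems
  have fin: "finite (verts G)" using G(1) unfolding simple_graph_def by blast
  show ?case
  proof (cases "verts G = {}")
    case True
    hence "edges G = {}" using G(1) unfolding simple_graph_def by auto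
    hence "is_disjoint_union G {}"
      using True unfolding is_disjoint_union_def disjoint_family_on_def by simp
    thus ?thesis by blast
  next
    case False
    obtain m p where p: "longest_path_in G m p" and m: "1 \<le> m"
      using longest_path_exists[OF fin False] .
    let ?S = "p ` {1..m}"
    let ?C = "spanned G ?S" and ?R = "spanned G (verts G - ?S)"
    have S: "?S \<subseteq> verts G" "?S \<noteq> {}"
      using p m unfolding longest_path_in_def path_in_def by auto
    have "simple_graph ?R"
      using G(1) unfolding simple_graph_def spanned_def by fastforce
    moreover have "max_degree_two ?R"
      using G(2) unfolding max_degree_two_def spanned_def by auto
    moreover have "card (verts ?R) < card (verts G)"
    proof -
      have "verts G - ?S \<subset> verts G" using S by blast
      thus ?thesis using psubset_card_mono[OF fin] unfolding spanned_def by simp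
    qed
    ultimately obtain \<H> where \<H>: "is_disjoint_union ?R \<H>" "\<forall>H\<in>\<H>. is_cycle H \<or> is_path H"
      using less.hyps by blast
    have "edges G \<subseteq> Pow (verts G)" using G(1) unfolding simple_graph_def by fastforce
    hence "edges G = edges ?C \<union> edges ?R"
      using longest_path_closed[OF G p] unfolding spanned_def sgraph.simps by blast
    moreover have "verts G = verts ?C \<union> verts ?R" using S(1) unfolding spanned_def by auto
    moreover have "disjoint_family_on verts (insert ?C \<H>)"
    proof -
      have "verts H \<inter> verts ?C = {}" if "H \<in> \<H>" for H
        using \<H>(1) that unfolding is_disjoint_union_def spanned_def by auto
      thus ?thesis using \<H>(1) unfolding is_disjoint_union_def disjoint_family_on_def by blast
    qed
    ultimately have "is_disjoint_union G (insert ?C \<H>)"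
      using \<H>(1) unfolding is_disjoint_union_def by simp
    thus ?thesis
      using \<H>(2) longest_path_spans_path_or_cycle[OF G p m] by blast
  qed
qed

section \<open>Triangle-free Toeplitz-row graphs\<close>

theorem corollary2p6:
  fixes G :: "'a sgraph"
  assumes "toeplitz_row_graph G"
    and "triangle_free G"
  shows "\<exists>\<H>. is_disjoint_union G \<H> \<and> (\<forall>H\<in>\<H>. is_cycle H \<or> is_path H)"
proof -
  obtain n \<alpha> \<beta> where iso: "graph_iso G (row_graph n (toeplitz_matrix \<alpha> \<beta>))"
    using assms(1) unfolding toeplitz_row_graph_def by blast
  have "max_degree_two G"
    using max_degree_two_iso[OF iso toeplitz_row_graph_degree[OF triangle_free_iso[OF iso assms(2)]]] .
  thus ?thesis
    using paths_and_cycles_if_max_degree_two simple_graph_iso[OF iso simple_row_graph] by blast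
qed

end
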